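(* Let $X$ be a finite metric space, $a_0\in X$, $P\subseteq\mathcal{P}_X$ with $P=P^{-1}$ and $X\setminus\{a_0\}\subseteq P(a_0)$. Let $(Y,\phi)$ be a finite minimal $P$-type S-extension of $X$, let $N=\ker(\phi)$ and $G=\Phi_N(\mathbb{F}(P))$. Then there is a $G$-invariant pseudometric $\rho$ on $\Gamma_N$ which is consistent with $w_N$ such that $(Y,\phi)$ is isomorphic to $(\overline{\Gamma_N},\overline{\Phi_N})$.
   Context: A partial isometry of $X$ is an isometry between finite subsets of $X$; $\mathcal{P}_X$ is the set of those not contained in the identity; $P(a_0)=\{p(a_0):p\in P,\ a_0\in\mathrm{dom}(p)\}$. A $P$-type S-extension of $X$ is $(Y,\phi)$ with $Y$ a metric space extending $X$ and $\phi:P\to\mathrm{Iso}(Y)$, $\phi(p)\restriction\mathrm{dom}(p)=p$; with $\phi(p^{-1})=\phi(p)^{-1}$ assumed, $\phi$ is extended to a homomorphism $\mathbb{F}(P)\to\mathrm{Iso}(Y)$, $\mathbb{F}(P)$ the free group on $P$ with $p^{-1}\in P$ identified with the formal inverse of $p$; $\ker(\phi)$ refers to this homomorphism. Minimal: every $y\in Y$ is $\phi(g)(a_0)$ for some $g$. Two $P$-type S-extensions $(Y,\phi),(Z,\psi)$ are isomorphic if there is an isometry $\pi:Y\to Z$ with $\psi(p)\circ\pi=\pi\circ\phi(p)$ for all $p\in P$. Let $H\le\mathbb{F}(P)$ be the subgroup of elements represented by words $p_1\cdots p_n$ ($p_i\in P$) such that $p_1(p_2(\cdots p_n(a_0)\cdots))$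 is defined and equals $a_0$. For $N\trianglelefteq\mathbb{F}(P)$ let $\Gamma_N=\{gNH:g\in\mathbb{F}(P)\}$. The weighted graph $(\Gamma_N,w_N)$ has an edge between $gpNH$ and $gqNH$ whenever $g\in\mathbb{F}(P)$, $p,q\in P\cup\{1\}$ with $p(a_0),q(a_0)$ defined and the cosets distinct, with weight $w_N=d_X(p(a_0),q(a_0))$ (this is well defined for $N=\ker\phi$). $\Phi_N:\mathbb{F}(P)\to\mathrm{Sym}(\Gamma_N)$ is $\Phi_N(g)(hNH)=ghNH$. A pseudometric $\rho$ on $\Gamma_N$ is consistent with $w_N$ if $\rho=w_N$ on every edge, and $G$-invariant if every element of $G$ preserves $\rho$. $(\overline{\Gamma_N},\overline\rho)$ is the metric identification of $(\Gamma_N,\rho)$ ($x\sim y$ iff $\rho(x,y)=0$), and $\overline{\Phi_N}(p)([x])=[\Phi_N(p)(x)]$ for $p\in P$. *)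

theory Defs
  imports "HOL-Analysis.Analysis" "HOL-Algebra.Coset" "HOL-Algebra.Bij"
begin

section \<open>Partial isometries\<close>

definition partial_isometry :: "'a set \<Rightarrow> ('a \<Rightarrow> 'a \<Rightarrow> real) \<Rightarrow> ('a \<rightharpoonup> 'a) \<Rightarrow> bool" where
  "partial_isometry X d p \<longleftrightarrow>
     finite (dom p) \<and> dom p \<subseteq> X \<and> ran p \<subseteq> X \<and>
     (\<forall>x\<in>dom p. \<forall>y\<in>dom p. d (the (p x)) (the (p y)) = d x y)"

definition nontrivial_partial_isometries :: "'a set \<Rightarrow> ('a \<Rightarrow> 'a \<Rightarrow> real) \<Rightarrow> ('a \<rightharpoonup> 'a) set" where
  "nontrivial_partial_isometries X d = {p. partial_isometry X d p \<and> \<not> p \<subseteq>\<^sub>m Some}"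

definition pinv :: "('a \<rightharpoonup> 'a) \<Rightarrow> ('a \<rightharpoonup> 'a)" where
  "pinv p = (\<lambda>y. if y \<in> ran p then Some (THE x. p x = Some y) else None)"

definition values_at :: "('a \<rightharpoonup> 'a) set \<Rightarrow> 'a \<Rightarrow> 'a set" where
  "values_at P a = {the (p a) | p. p \<in> P \<and> a \<in> dom p}"

text \<open>The word \<open>[p\<^sub>1, \<dots>, p\<^sub>n]\<close> acts as \<open>p\<^sub>1 (p\<^sub>2 (\<dots> (p\<^sub>n x)))\<close>; the result is
  \<^const>\<open>None\<close> if one of the applications is undefined.\<close>

definition word_apply :: "('a \<rightharpoonup> 'a) list \<Rightarrow> 'a \<Rightarrow> 'a option" where
  "word_apply w x = foldr (\<lambda>p z. Option.bind z p) w (Some x)"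


section \<open>The free group on \<open>P\<close>\<close>

text \<open>The formal inverse of the generator \<open>p\<close> is the generator \<open>pinv p\<close>, so elements are classes
  of words over \<open>P\<close> modulo insertion and deletion of factors \<open>p \<cdot> pinv p\<close>.
  In particular, a generator with \<open>pinv p = p\<close> has square \<open>1\<close>.\<close>

definition free_step :: "('a \<rightharpoonup> 'a) set \<Rightarrow> ('a \<rightharpoonup> 'a) list \<Rightarrow> ('a \<rightharpoonup> 'a) list \<Rightarrow> bool" where
  "free_step P v w \<longleftrightarrow>
     (\<exists>s\<in>lists P. \<exists>t\<in>lists P. \<exists>p\<in>P. v = s @ [p, pinv p] @ t \<and> w = s @ t)"

definition free_rel :: "('a \<rightharpoonup> 'a) set \<Rightarrow> (('a \<rightharpoonup> 'a) list \<times> ('a \<rightharpoonup> 'a) list) set" where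
  "free_rel P = {(v, w). v \<in> lists P \<and> w \<in> lists P \<and> equivclp (free_step P) v w}"

definition word_class :: "('a \<rightharpoonup> 'a) set \<Rightarrow> ('a \<rightharpoonup> 'a) list \<Rightarrow> ('a \<rightharpoonup> 'a) list set" where
  "word_class P w = free_rel P `` {w}"

definition free_group :: "('a \<rightharpoonup> 'a) set \<Rightarrow> ('a \<rightharpoonup> 'a) list set monoid" where
  "free_group P =
     \<lparr>carrier = lists P // free_rel P,
      mult = \<lambda>A B. \<Union>v\<in>A. \<Union>w\<in>B. word_class P (v @ w),
      one = word_class P []\<rparr>"

text \<open>The extension of \<open>\<phi> : P \<rightarrow> K\<close> to the free group. The image below is a singleton whenever
  \<open>\<phi> (pinv p) = inv (\<phi> p)\<close> holds for all \<open>p \<in> P\<close>.\<close>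

definition free_extend ::
  "('b, 'm) monoid_scheme \<Rightarrow> (('a \<rightharpoonup> 'a) \<Rightarrow> 'b) \<Rightarrow> ('a \<rightharpoonup> 'a) list set \<Rightarrow> 'b" where
  "free_extend K \<phi> A =
     the_elem ((\<lambda>w. foldr (\<lambda>p f. \<phi> p \<otimes>\<^bsub>K\<^esub> f) w \<one>\<^bsub>K\<^esub>) ` A)"

definition point_stabilizer :: "('a \<rightharpoonup> 'a) set \<Rightarrow> 'a \<Rightarrow> ('a \<rightharpoonup> 'a) list set set" where
  "point_stabilizer P a = {word_class P w | w. w \<in> lists P \<and> word_apply w a = Some a}"


section \<open>S-extensions\<close>

definition Iso_group :: "'b set \<Rightarrow> ('b \<Rightarrow> 'b \<Rightarrow> real) \<Rightarrow> ('b \<Rightarrow> 'b) monoid" where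
  "Iso_group Y d =
     (BijGroup Y)\<lparr>carrier := {f \<in> Bij Y. \<forall>x\<in>Y. \<forall>y\<in>Y. d (f x) (f y) = d x y}\<rparr>"

text \<open>That \<open>(Y, dY)\<close> extends \<open>(X, dX)\<close> is expressed by an isometric embedding \<open>\<iota> : X \<rightarrow> Y\<close> along
  which \<open>X\<close> is regarded as a subspace of \<open>Y\<close>; for \<open>X \<subseteq> Y\<close> take \<open>\<iota> = id\<close>.\<close>

definition S_extension ::
  "'a set \<Rightarrow> ('a \<Rightarrow> 'a \<Rightarrow> real) \<Rightarrow> ('a \<rightharpoonup> 'a) set \<Rightarrow>
   'b set \<Rightarrow> ('b \<Rightarrow> 'b \<Rightarrow> real) \<Rightarrow> ('a \<Rightarrow> 'b) \<Rightarrow> (('a \<rightharpoonup> 'a) \<Rightarrow> 'b \<Rightarrow> 'b) \<Rightarrow> bool" where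
  "S_extension X dX P Y dY \<iota> \<phi> \<longleftrightarrow>
     Metric_space Y dY \<and>
     \<iota> \<in> X \<rightarrow> Y \<and> (\<forall>x\<in>X. \<forall>x'\<in>X. dY (\<iota> x) (\<iota> x') = dX x x') \<and>
     \<phi> \<in> P \<rightarrow> carrier (Iso_group Y dY) \<and>
     (\<forall>p\<in>P. \<forall>x\<in>dom p. \<phi> p (\<iota> x) = \<iota> (the (p x))) \<and>
     (\<forall>p\<in>P. \<phi> (pinv p) = inv\<^bsub>Iso_group Y dY\<^esub> (\<phi> p))"

definition minimal_S_extension ::
  "'a \<Rightarrow> ('a \<rightharpoonup> 'a) set \<Rightarrow>
   'b set \<Rightarrow> ('b \<Rightarrow> 'b \<Rightarrow> real) \<Rightarrow> ('a \<Rightarrow> 'b) \<Rightarrow> (('a \<rightharpoonup> 'a) \<Rightarrow> 'b \<Rightarrow> 'b) \<Rightarrow> bool" where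
  "minimal_S_extension a P Y dY \<iota> \<phi> \<longleftrightarrow>
     (\<forall>y\<in>Y. \<exists>g\<in>carrier (free_group P). free_extend (Iso_group Y dY) \<phi> g (\<iota> a) = y)"

definition S_extension_isomorphic ::
  "('a \<rightharpoonup> 'a) set \<Rightarrow>
   'b set \<Rightarrow> ('b \<Rightarrow> 'b \<Rightarrow> real) \<Rightarrow> (('a \<rightharpoonup> 'a) \<Rightarrow> 'b \<Rightarrow> 'b) \<Rightarrow>
   'c set \<Rightarrow> ('c \<Rightarrow> 'c \<Rightarrow> real) \<Rightarrow> (('a \<rightharpoonup> 'a) \<Rightarrow> 'c \<Rightarrow> 'c) \<Rightarrow> bool" where
  "S_extension_isomorphic P Y dY \<phi> Z dZ \<psi> \<longleftrightarrow>
     (\<exists>\<pi>. bij_betw \<pi> Y Z \<and> (\<forall>x\<in>Y. \<forall>y\<in>Y. dZ (\<pi> x) (\<pi> y) = dY x y) \<and>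
          (\<forall>p\<in>P. \<forall>y\<in>Y. \<psi> p (\<pi> y) = \<pi> (\<phi> p y)))"


section \<open>The coset graph\<close>

definition NH_coset ::
  "('a \<rightharpoonup> 'a) set \<Rightarrow> 'a \<Rightarrow> ('a \<rightharpoonup> 'a) list set set \<Rightarrow> ('a \<rightharpoonup> 'a) list set \<Rightarrow> ('a \<rightharpoonup> 'a) list set set"
  where
  "NH_coset P a N g =
     g <#\<^bsub>free_group P\<^esub> (N <#>\<^bsub>free_group P\<^esub> point_stabilizer P a)"

definition coset_space ::
  "('a \<rightharpoonup> 'a) set \<Rightarrow> 'a \<Rightarrow> ('a \<rightharpoonup> 'a) list set set \<Rightarrow> ('a \<rightharpoonup> 'a) list set set set" where
  "coset_space P a N = NH_coset P a N ` carrier (free_group P)"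

text \<open>\<open>P \<union> {1}\<close> as words of length at most one; the empty word is \<open>1\<close>, with \<open>1(a) = a\<close>.\<close>

definition letters1 :: "('a \<rightharpoonup> 'a) set \<Rightarrow> ('a \<rightharpoonup> 'a) list set" where
  "letters1 P = insert [] ((\<lambda>p. [p]) ` P)"

text \<open>\<open>C\<close> and \<open>D\<close> are joined by an edge carrying the weight \<open>r\<close>. The weight is a function of the edge
  for \<open>N = ker \<phi>\<close>; as a relation it makes sense for every \<open>N\<close>.\<close>

definition weighted_edge ::
  "('a \<Rightarrow> 'a \<Rightarrow> real) \<Rightarrow> ('a \<rightharpoonup> 'a) set \<Rightarrow> 'a \<Rightarrow> ('a \<rightharpoonup> 'a) list set set \<Rightarrow>
   ('a \<rightharpoonup> 'a) list set set \<Rightarrow> ('a \<rightharpoonup> 'a) list set set \<Rightarrow> real \<Rightarrow> bool" where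
  "weighted_edge dX P a N C D r \<longleftrightarrow> C \<noteq> D \<and>
     (\<exists>g\<in>carrier (free_group P). \<exists>p\<in>letters1 P. \<exists>q\<in>letters1 P. \<exists>x y.
        word_apply p a = Some x \<and> word_apply q a = Some y \<and>
        C = NH_coset P a N (g \<otimes>\<^bsub>free_group P\<^esub> word_class P p) \<and>
        D = NH_coset P a N (g \<otimes>\<^bsub>free_group P\<^esub> word_class P q) \<and>
        r = dX x y)"

definition consistent_with_weights ::
  "('a \<Rightarrow> 'a \<Rightarrow> real) \<Rightarrow> ('a \<rightharpoonup> 'a) set \<Rightarrow> 'a \<Rightarrow> ('a \<rightharpoonup> 'a) list set set \<Rightarrow>
   (('a \<rightharpoonup> 'a) list set set \<Rightarrow> ('a \<rightharpoonup> 'a) list set set \<Rightarrow> real) \<Rightarrow> bool" where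
  "consistent_with_weights dX P a N \<rho> \<longleftrightarrow>
     (\<forall>C D r. weighted_edge dX P a N C D r \<longrightarrow> \<rho> C D = r)"

definition coset_action ::
  "('a \<rightharpoonup> 'a) set \<Rightarrow> 'a \<Rightarrow> ('a \<rightharpoonup> 'a) list set set \<Rightarrow> ('a \<rightharpoonup> 'a) list set \<Rightarrow>
   ('a \<rightharpoonup> 'a) list set set \<Rightarrow> ('a \<rightharpoonup> 'a) list set set" where
  "coset_action P a N g = (\<lambda>C\<in>coset_space P a N. g <#\<^bsub>free_group P\<^esub> C)"


section \<open>Pseudometrics and metric identification\<close>

definition pseudometric_on :: "'c set \<Rightarrow> ('c \<Rightarrow> 'c \<Rightarrow> real) \<Rightarrow> bool" where
  "pseudometric_on M \<rho> \<longleftrightarrow>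
     (\<forall>x\<in>M. \<rho> x x = 0) \<and>
     (\<forall>x\<in>M. \<forall>y\<in>M. 0 \<le> \<rho> x y \<and> \<rho> x y = \<rho> y x) \<and>
     (\<forall>x\<in>M. \<forall>y\<in>M. \<forall>z\<in>M. \<rho> x z \<le> \<rho> x y + \<rho> y z)"

definition invariant_under :: "('c \<Rightarrow> 'c) set \<Rightarrow> 'c set \<Rightarrow> ('c \<Rightarrow> 'c \<Rightarrow> real) \<Rightarrow> bool" where
  "invariant_under G M \<rho> \<longleftrightarrow> (\<forall>f\<in>G. \<forall>x\<in>M. \<forall>y\<in>M. \<rho> (f x) (f y) = \<rho> x y)"

definition zero_rel :: "'c set \<Rightarrow> ('c \<Rightarrow> 'c \<Rightarrow> real) \<Rightarrow> ('c \<times> 'c) set" where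
  "zero_rel M \<rho> = {(x, y). x \<in> M \<and> y \<in> M \<and> \<rho> x y = 0}"

definition ident_space :: "'c set \<Rightarrow> ('c \<Rightarrow> 'c \<Rightarrow> real) \<Rightarrow> 'c set set" where
  "ident_space M \<rho> = M // zero_rel M \<rho>"

text \<open>The value \<open>0\<close> off the carrier is there because \<^locale>\<open>Metric_space\<close> demands
  nonnegativity and symmetry on the whole type.\<close>

definition ident_dist :: "'c set \<Rightarrow> ('c \<Rightarrow> 'c \<Rightarrow> real) \<Rightarrow> 'c set \<Rightarrow> 'c set \<Rightarrow> real" where
  "ident_dist M \<rho> A B =
     (if A \<in> ident_space M \<rho> \<and> B \<in> ident_space M \<rho>
      then the_elem {\<rho> x y | x y. x \<in> A \<and> y \<in> B} else 0)"

definition ident_map :: "'c set \<Rightarrow> ('c \<Rightarrow> 'c \<Rightarrow> real) \<Rightarrow> ('c \<Rightarrow> 'c) \<Rightarrow> 'c set \<Rightarrow> 'c set" where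
  "ident_map M \<rho> f = (\<lambda>A\<in>ident_space M \<rho>. \<Union>x\<in>A. zero_rel M \<rho> `` {f x})"

definition ident_action ::
  "('a \<rightharpoonup> 'a) set \<Rightarrow> 'a \<Rightarrow> ('a \<rightharpoonup> 'a) list set set \<Rightarrow>
   (('a \<rightharpoonup> 'a) list set set \<Rightarrow> ('a \<rightharpoonup> 'a) list set set \<Rightarrow> real) \<Rightarrow> ('a \<rightharpoonup> 'a) \<Rightarrow>
   ('a \<rightharpoonup> 'a) list set set set \<Rightarrow> ('a \<rightharpoonup> 'a) list set set set" where
  "ident_action P a N \<rho> p =
     ident_map (coset_space P a N) \<rho> (coset_action P a N (word_class P [p]))"

text \<open>The copy of \<open>X\<close> inside the metric identification of \<open>\<Gamma>\<^sub>N\<close>: the point \<open>p(a)\<close>, for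
  \<open>p \<in> P \<union> {1}\<close>, is identified with the class of \<open>pNH\<close>.\<close>

definition ident_embedding ::
  "('a \<rightharpoonup> 'a) set \<Rightarrow> 'a \<Rightarrow> ('a \<rightharpoonup> 'a) list set set \<Rightarrow>
   (('a \<rightharpoonup> 'a) list set set \<Rightarrow> ('a \<rightharpoonup> 'a) list set set \<Rightarrow> real) \<Rightarrow> 'a \<Rightarrow>
   ('a \<rightharpoonup> 'a) list set set set" where
  "ident_embedding P a N \<rho> x =
     (THE A. \<exists>p\<in>letters1 P. word_apply p a = Some x \<and>
        A = zero_rel (coset_space P a N) \<rho> `` {NH_coset P a N (word_class P p)})"

end

theory Submission
  imports Defs
begin

text \<open>Sending the coset \<open>gNH\<close> to \<open>\<phi>(g)(a\<^sub>0)\<close> is well defined, because \<open>N\<close> and \<open>H\<close> both fix \<open>a\<^sub>0\<close>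
  under \<open>\<phi>\<close>, and equivariant; by minimality it maps \<open>\<Gamma>\<^sub>N\<close> onto \<open>Y\<close>. The pseudometric \<open>\<rho>\<close> is the
  pullback of \<open>d\<^sub>Y\<close> along this map \<open>F\<close>. Its metric identification consists of the fibres of \<open>F\<close>,
  hence is a copy of \<open>Y\<close>, and the isomorphism sends \<open>y\<close> to the fibre over \<open>y\<close>.\<close>

section \<open>The isometry group\<close>

text \<open>Makes \<open>Iso_group\<close> inherit the group laws of the permutations of
  \<open>Y\<close>. An inverse preserves distances because \<open>f\<close> does so on the
  preimages.\<close>

lemma Iso_subgroup: "subgroup {f \<in> Bij Y. \<forall>x\<in>Y. \<forall>y\<in>Y. d (f x) (f y) = d x y} (BijGroup Y)"
proof (rule group.subgroupI[OF group_BijGroup])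
  show "{f \<in> Bij Y. \<forall>x\<in>Y. \<forall>y\<in>Y. d (f x) (f y) = d x y} \<subseteq> carrier (BijGroup Y)"
    by (auto simp: BijGroup_def)
  have "(\<lambda>x\<in>Y. x) \<in> {f \<in> Bij Y. \<forall>x\<in>Y. \<forall>y\<in>Y. d (f x) (f y) = d x y}"
    by (simp add: id_Bij)
  then show "{f \<in> Bij Y. \<forall>x\<in>Y. \<forall>y\<in>Y. d (f x) (f y) = d x y} \<noteq> {}" by blast
next
  fix f assume f: "f \<in> {f \<in> Bij Y. \<forall>x\<in>Y. \<forall>y\<in>Y. d (f x) (f y) = d x y}"
  then have bij: "bij_betw f Y Y" and F: "f \<in> Bij Y" by (auto simp: Bij_def)
  have "d (inv_into Y f x) (inv_into Y f y) = d x y" if "x \<in> Y" "y \<in> Y" for x y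
  proof -
    have "inv_into Y f x \<in> Y" "inv_into Y f y \<in> Y"
      using bij that by (metis bij_betw_def inv_into_into)+
    then have "d (f (inv_into Y f x)) (f (inv_into Y f y)) = d (inv_into Y f x) (inv_into Y f y)"
      using f by blast
    then show ?thesis using bij that by (simp add: bij_betw_inv_into_right)
  qed
  then show "inv\<^bsub>BijGroup Y\<^esub> f \<in> {f \<in> Bij Y. \<forall>x\<in>Y. \<forall>y\<in>Y. d (f x) (f y) = d x y}"
    using F by (simp add: inv_BijGroup restrict_inv_into_Bij)
next
  fix f g
  assume "f \<in> {f \<in> Bij Y. \<forall>x\<in>Y. \<forall>y\<in>Y. d (f x) (f y) = d x y}"
    and "g \<in> {f \<in> Bij Y. \<forall>x\<in>Y. \<forall>y\<in>Y. d (f x) (f y) = d x y}"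
  then show "f \<otimes>\<^bsub>BijGroup Y\<^esub> g \<in> {f \<in> Bij Y. \<forall>x\<in>Y. \<forall>y\<in>Y. d (f x) (f y) = d x y}"
    using Bij_imp_funcset[of g Y]
    by (auto simp: BijGroup_def compose_Bij compose_eq Pi_iff)
qed

lemma group_Iso: "group (Iso_group Y d)"
  unfolding Iso_group_def
  by (rule group.subgroup_imp_group[OF group_BijGroup Iso_subgroup])

lemma carrier_Iso:
  "carrier (Iso_group Y d) = {f \<in> Bij Y. \<forall>x\<in>Y. \<forall>y\<in>Y. d (f x) (f y) = d x y}"
  by (simp add: Iso_group_def)

lemma Iso_closed: "f \<in> carrier (Iso_group Y d) \<Longrightarrow> y \<in> Y \<Longrightarrow> f y \<in> Y"
  by (auto simp: carrier_Iso dest: Bij_imp_funcset)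

lemma Iso_dist:
  "f \<in> carrier (Iso_group Y d) \<Longrightarrow> x \<in> Y \<Longrightarrow> y \<in> Y \<Longrightarrow> d (f x) (f y) = d x y"
  by (simp add: carrier_Iso)

lemma one_Iso: "\<one>\<^bsub>Iso_group Y d\<^esub> = (\<lambda>y\<in>Y. y)"
  by (simp add: Iso_group_def BijGroup_def)

lemma mult_Iso:
  "f \<in> carrier (Iso_group Y d) \<Longrightarrow> g \<in> carrier (Iso_group Y d) \<Longrightarrow>
    f \<otimes>\<^bsub>Iso_group Y d\<^esub> g = compose Y f g"
  by (simp add: Iso_group_def BijGroup_def)

lemma mult_Iso_apply:
  "f \<in> carrier (Iso_group Y d) \<Longrightarrow> g \<in> carrier (Iso_group Y d) \<Longrightarrow> y \<in> Y \<Longrightarrow>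
    (f \<otimes>\<^bsub>Iso_group Y d\<^esub> g) y = f (g y)"
  by (simp add: mult_Iso compose_eq)

section \<open>The free group\<close>

lemma equiv_free_rel: "equiv (lists P) (free_rel P)"
proof (rule equivI)
  show "free_rel P \<subseteq> lists P \<times> lists P" "refl_on (lists P) (free_rel P)"
    by (auto simp: free_rel_def refl_on_def)
  show "sym (free_rel P)"
    by (auto simp: free_rel_def sym_def intro: equivclp_sym)
  show "trans (free_rel P)"
    by (auto simp: free_rel_def trans_def intro: equivclp_trans)
qed

lemma free_step_append:
  assumes "free_step P v w" "s \<in> lists P" "t \<in> lists P"
  shows "free_step P (s @ v @ t) (s @ w @ t)"
proof -
  obtain s' t' p where "s' \<in> lists P" "t' \<in> lists P" "p \<in> P"
    "v = s' @ [p, pinv p] @ t'" "w = s' @ t'"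
    using assms(1) unfolding free_step_def by blast
  then have "s @ s' \<in> lists P" "t' @ t \<in> lists P" "p \<in> P"
    "s @ v @ t = (s @ s') @ [p, pinv p] @ (t' @ t)" "s @ w @ t = (s @ s') @ (t' @ t)"
    using assms by auto
  then show ?thesis unfolding free_step_def by blast
qed

lemma equivclp_free_step_append:
  assumes "equivclp (free_step P) v w" and st: "s \<in> lists P" "t \<in> lists P"
  shows "equivclp (free_step P) (s @ v @ t) (s @ w @ t)"
  using assms(1)
proof (induction rule: equivclp_induct)
  case base
  show ?case by simp
next
  case (step y z)
  then have "equivclp (free_step P) (s @ y @ t) (s @ z @ t)"
    using free_step_append[OF _ st] by (meson equivclp_sym r_into_equivclp)
  with step show ?case by (blast intro: equivclp_trans)
qed

text \<open>One factor is changed at a time, the other serving as the surrounding context of the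
  reduction steps. This congruence is what lets concatenation descend to classes.\<close>

lemma free_rel_append:
  assumes "(v, v') \<in> free_rel P" "(w, w') \<in> free_rel P"
  shows "(v @ w, v' @ w') \<in> free_rel P"
proof -
  have L: "v \<in> lists P" "v' \<in> lists P" "w \<in> lists P" "w' \<in> lists P"
    and e: "equivclp (free_step P) v v'" "equivclp (free_step P) w w'"
    using assms by (auto simp: free_rel_def)
  have "equivclp (free_step P) (v @ w) (v' @ w)"
    using equivclp_free_step_append[OF e(1), of "[]" w] L by simp
  moreover have "equivclp (free_step P) (v' @ w) (v' @ w')"
    using equivclp_free_step_append[OF e(2), of v' "[]"] L by simp
  ultimately show ?thesis
    using L by (auto simp: free_rel_def intro: equivclp_trans)
qed

lemma word_class_self: "w \<in> lists P \<Longrightarrow> w \<in> word_class P w"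
  unfolding word_class_def by (rule equiv_class_self[OF equiv_free_rel])

lemma carrier_free_group: "carrier (free_group P) = word_class P ` lists P"
  by (auto simp: free_group_def quotient_def word_class_def)

lemma word_class_closed [simp]: "w \<in> lists P \<Longrightarrow> word_class P w \<in> carrier (free_group P)"
  by (simp add: carrier_free_group)

lemma one_free_group: "\<one>\<^bsub>free_group P\<^esub> = word_class P []"
  by (simp add: free_group_def)

text \<open>The product in \<open>free_group\<close> is a union over all pairs of representatives;
  by \<open>free_rel_append\<close> every member of that union is the same class.\<close>

lemma mult_word_class:
  assumes "v \<in> lists P" "w \<in> lists P"
  shows "word_class P v \<otimes>\<^bsub>free_group P\<^esub> word_class P w = word_class P (v @ w)"
proof -
  have "word_class P (v' @ w') = word_class P (v @ w)"
    if "v' \<in> word_class P v" "w' \<in> word_class P w" for v' w'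
    using free_rel_append[of v v' P w w'] that
    by (simp add: word_class_def equiv_class_eq[OF equiv_free_rel])
  moreover have "v \<in> word_class P v" "w \<in> word_class P w"
    using assms by (simp_all add: word_class_self)
  ultimately have "(\<Union>v'\<in>word_class P v. \<Union>w'\<in>word_class P w. word_class P (v' @ w'))
      = word_class P (v @ w)" by blast
  then show ?thesis by (simp add: free_group_def)
qed

lemma free_group_cases:
  assumes "g \<in> carrier (free_group P)"
  obtains w where "w \<in> lists P" "g = word_class P w"
  using assms unfolding carrier_free_group by blast

lemma free_group_mult_closed:
  assumes "g \<in> carrier (free_group P)" "h \<in> carrier (free_group P)"
  shows "g \<otimes>\<^bsub>free_group P\<^esub> h \<in> carrier (free_group P)"
proof -
  obtain v w where "v \<in> lists P" "g = word_class P v" "w \<in> lists P" "h = word_class P w"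
    using assms by (meson free_group_cases)
  then show ?thesis by (simp add: mult_word_class)
qed

text \<open>Associativity will move a left multiplication through a coset, and the unit laws will
  place \<open>1\<close> in \<open>NH\<close>.\<close>

lemma monoid_free_group: "monoid (free_group P)"
proof (rule monoidI)
  fix x y z
  assume "x \<in> carrier (free_group P)" "y \<in> carrier (free_group P)" "z \<in> carrier (free_group P)"
  then obtain u v w where "u \<in> lists P" "x = word_class P u" "v \<in> lists P" "y = word_class P v"
    "w \<in> lists P" "z = word_class P w"
    by (meson free_group_cases)
  then show "x \<otimes>\<^bsub>free_group P\<^esub> y \<otimes>\<^bsub>free_group P\<^esub> z = x \<otimes>\<^bsub>free_group P\<^esub> (y \<otimes>\<^bsub>free_group P\<^esub> z)"
    by (simp add: mult_word_class)
next
  fix x assume "x \<in> carrier (free_group P)"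
  then obtain w where "w \<in> lists P" "x = word_class P w" by (rule free_group_cases)
  then show "\<one>\<^bsub>free_group P\<^esub> \<otimes>\<^bsub>free_group P\<^esub> x = x" "x \<otimes>\<^bsub>free_group P\<^esub> \<one>\<^bsub>free_group P\<^esub> = x"
    by (simp_all add: one_free_group mult_word_class)
qed (simp_all add: free_group_mult_closed one_free_group)

section \<open>Evaluation of words in a group and its descent to the free group\<close>

definition word_eval ::
  "('b, 'm) monoid_scheme \<Rightarrow> (('a \<rightharpoonup> 'a) \<Rightarrow> 'b) \<Rightarrow> ('a \<rightharpoonup> 'a) list \<Rightarrow> 'b" where
  "word_eval K \<phi> w = foldr (\<lambda>p f. \<phi> p \<otimes>\<^bsub>K\<^esub> f) w \<one>\<^bsub>K\<^esub>"

lemma word_eval_simps [simp]: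
  "word_eval K \<phi> [] = \<one>\<^bsub>K\<^esub>" "word_eval K \<phi> (p # w) = \<phi> p \<otimes>\<^bsub>K\<^esub> word_eval K \<phi> w"
  by (simp_all add: word_eval_def)

text \<open>The data for the universal property of the free group: as formal inverses are themselves
  letters, the map on letters must already turn \<open>pinv\<close> into inversion.\<close>

locale letter_hom = group K for K (structure) +
  fixes P :: "('a \<rightharpoonup> 'a) set" and \<phi>
  assumes pinv_P: "pinv ` P = P"
    and letter_closed: "\<phi> \<in> P \<rightarrow> carrier K"
    and letter_pinv: "p \<in> P \<Longrightarrow> \<phi> (pinv p) = inv (\<phi> p)"
begin

lemma word_eval_closed: "w \<in> lists P \<Longrightarrow> word_eval K \<phi> w \<in> carrier K"
  using letter_closed by (induction w) auto

lemma word_eval_append: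
  "v \<in> lists P \<Longrightarrow> w \<in> lists P \<Longrightarrow> word_eval K \<phi> (v @ w) = word_eval K \<phi> v \<otimes> word_eval K \<phi> w"
proof (induction v)
  case (Cons p v)
  then have "\<phi> p \<in> carrier K" using letter_closed by auto
  with Cons show ?case by (simp add: m_assoc word_eval_closed)
qed (simp add: word_eval_closed)

text \<open>The deleted factor contributes \<open>\<phi> p\<close> times its inverse, which is
  1.\<close>

lemma word_eval_free_step:
  assumes "free_step P v w"
  shows "word_eval K \<phi> v = word_eval K \<phi> w"
proof -
  obtain s t p where st: "s \<in> lists P" "t \<in> lists P" and p: "p \<in> P"
    and vw: "v = s @ [p, pinv p] @ t" "w = s @ t"
    using assms unfolding free_step_def by blast
  have "pinv p \<in> P" "\<phi> p \<in> carrier K" using p pinv_P letter_closed by auto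
  then have "word_eval K \<phi> ([p, pinv p] @ t) = word_eval K \<phi> t"
    using st p by (simp add: letter_pinv word_eval_closed flip: m_assoc)
  then show ?thesis
    using st p \<open>pinv p \<in> P\<close> unfolding vw by (simp add: word_eval_append)
qed

lemma word_eval_cong:
  assumes "(v, w) \<in> free_rel P"
  shows "word_eval K \<phi> v = word_eval K \<phi> w"
proof -
  have "equivclp (free_step P) v w" using assms by (simp add: free_rel_def)
  then show ?thesis
    by (induction rule: equivclp_induct) (auto dest: word_eval_free_step)
qed

text \<open>Evaluation is constant on a class by \<open>word_eval_cong\<close>, so the image inside
  \<open>free_extend\<close> is a singleton and \<open>the_elem\<close> returns its member.\<close>

lemma free_extend_word_class:
  assumes "w \<in> lists P"
  shows "free_extend K \<phi> (word_class P w) = word_eval K \<phi> w"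
proof -
  have "word_eval K \<phi> v = word_eval K \<phi> w" if "v \<in> word_class P w" for v
    using word_eval_cong[of w v] that by (simp add: word_class_def)
  then have "word_eval K \<phi> ` word_class P w = {word_eval K \<phi> w}"
    using word_class_self[OF assms] by blast
  then show ?thesis by (simp add: free_extend_def word_eval_def)
qed

lemma free_extend_closed: "g \<in> carrier (free_group P) \<Longrightarrow> free_extend K \<phi> g \<in> carrier K"
  by (metis free_group_cases free_extend_word_class word_eval_closed)

lemma free_extend_mult:
  assumes "g \<in> carrier (free_group P)" "h \<in> carrier (free_group P)"
  shows "free_extend K \<phi> (g \<otimes>\<^bsub>free_group P\<^esub> h) = free_extend K \<phi> g \<otimes> free_extend K \<phi> h"
proof -
  obtain v w where "v \<in> lists P" "g = word_class P v" "w \<in> lists P" "h = word_class P w"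
    using assms by (meson free_group_cases)
  then show ?thesis
    by (simp add: mult_word_class free_extend_word_class word_eval_append)
qed

end

section \<open>Pullbacks of metrics\<close>

text \<open>Isolates the metric half of the argument, free of groups: later \<open>M\<close> is the
  coset space and \<open>F\<close> the orbit map.\<close>

locale metric_pullback = Metric_space Y d for Y :: "'b set" and d +
  fixes M :: "'c set" and F :: "'c \<Rightarrow> 'b"
  assumes F_onto: "F ` M = Y"
begin

definition pull :: "'c \<Rightarrow> 'c \<Rightarrow> real" where
  "pull x y = d (F x) (F y)"

definition fibre :: "'b \<Rightarrow> 'c set" where
  "fibre y = {x \<in> M. F x = y}"

lemma F_in: "x \<in> M \<Longrightarrow> F x \<in> Y"
  using F_onto by blast

lemma fibre_nonempty: "y \<in> Y \<Longrightarrow> \<exists>x. x \<in> fibre y"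
  using F_onto by (auto simp: fibre_def)

lemma pseudometric_pull: "pseudometric_on M pull"
  unfolding pseudometric_on_def pull_def
  by (auto simp: F_in commute intro: triangle)

text \<open>Since \<open>d\<close> separates points of \<open>Y\<close>, pulled back distance 0
  means equal images.\<close>

lemma zero_rel_pull: "x \<in> M \<Longrightarrow> zero_rel M pull `` {x} = fibre (F x)"
  by (auto simp: zero_rel_def pull_def fibre_def F_in)

lemma ident_space_pull: "ident_space M pull = fibre ` Y"
proof -
  have "ident_space M pull = (\<lambda>x. fibre (F x)) ` M"
    by (auto simp: ident_space_def quotient_def zero_rel_pull)
  then show ?thesis using F_onto by (metis image_image)
qed

text \<open>By surjectivity of \<open>F\<close> each fibre has a point, and that point determines
  where the fibre lies.\<close>

lemma fibre_inj: "inj_on fibre Y"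
  by (rule inj_onI) (use fibre_nonempty in \<open>fastforce simp: fibre_def\<close>)

lemma fibre_bij: "bij_betw fibre Y (ident_space M pull)"
  by (simp add: bij_betw_def fibre_inj ident_space_pull)

text \<open>\<open>pull\<close> is constant on a pair of fibres, and both are nonempty, so the set
  under \<open>the_elem\<close> is a singleton.\<close>

lemma ident_dist_fibre:
  assumes "y \<in> Y" "z \<in> Y"
  shows "ident_dist M pull (fibre y) (fibre z) = d y z"
proof -
  have "{pull u v | u v. u \<in> fibre y \<and> v \<in> fibre z} = {d y z}"
    using fibre_nonempty[OF assms(1)] fibre_nonempty[OF assms(2)]
    by (auto simp: pull_def fibre_def)
  then show ?thesis using assms by (simp add: ident_dist_def ident_space_pull)
qed

lemma Metric_space_ident: "Metric_space (ident_space M pull) (ident_dist M pull)"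
proof
  fix A B
  have *: "\<exists>y\<in>Y. C = fibre y" if "C \<in> ident_space M pull" for C
    using that by (auto simp: ident_space_pull)
  \<comment> \<open>Nonnegativity and symmetry are demanded for arbitrary sets \<open>A\<close> and
    \<open>B\<close>; off the carrier both distances take the default value 0.\<close>
  have off: "ident_dist M pull A B = 0" "ident_dist M pull B A = 0"
    if "\<not> (A \<in> ident_space M pull \<and> B \<in> ident_space M pull)"
    using that by (auto simp: ident_dist_def)
  show "0 \<le> ident_dist M pull A B"
    using * off by (metis ident_dist_fibre nonneg order_refl)
  show "ident_dist M pull A B = ident_dist M pull B A"
    using * off by (metis ident_dist_fibre commute)
next
  fix A B assume "A \<in> ident_space M pull" "B \<in> ident_space M pull"
  then show "ident_dist M pull A B = 0 \<longleftrightarrow> A = B"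
    by (auto simp: ident_space_pull ident_dist_fibre)
next
  fix A B C
  assume "A \<in> ident_space M pull" "B \<in> ident_space M pull" "C \<in> ident_space M pull"
  then show "ident_dist M pull A C \<le> ident_dist M pull A B + ident_dist M pull B C"
    by (auto simp: ident_space_pull ident_dist_fibre triangle)
qed

text \<open>If \<open>f\<close> lies over \<open>h\<close>, it sends the fibre over \<open>y\<close>
  into the fibre over \<open>h y\<close>, so the union in \<open>ident_map\<close> joins copies of
  one class.\<close>

lemma ident_map_fibre:
  assumes "\<And>x. x \<in> M \<Longrightarrow> f x \<in> M \<and> F (f x) = h (F x)" and y: "y \<in> Y"
  shows "ident_map M pull f (fibre y) = fibre (h y)"
proof -
  have "zero_rel M pull `` {f x} = fibre (h y)" if "x \<in> fibre y" for x
    using that assms by (auto simp: fibre_def zero_rel_pull)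
  then have "(\<Union>x\<in>fibre y. zero_rel M pull `` {f x}) = fibre (h y)"
    using fibre_nonempty[OF y] by blast
  then show ?thesis using y by (simp add: ident_map_def ident_space_pull)
qed

end

section \<open>Transport of S-extensions\<close>

text \<open>On \<open>Z\<close> the map \<open>h\<close> is the conjugate of \<open>f\<close> by
  \<open>\<pi>\<close>. Membership in \<open>Bij Z\<close> also requires \<open>h\<close> to be
  extensional.\<close>

lemma Iso_transport:
  assumes bij: "bij_betw \<pi> Y Z"
    and iso: "\<And>x y. x \<in> Y \<Longrightarrow> y \<in> Y \<Longrightarrow> dZ (\<pi> x) (\<pi> y) = dY x y"
    and f: "f \<in> carrier (Iso_group Y dY)"
    and h: "h \<in> extensional Z" "\<And>y. y \<in> Y \<Longrightarrow> h (\<pi> y) = \<pi> (f y)"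
  shows "h \<in> carrier (Iso_group Z dZ)"
proof -
  have Z: "Z = \<pi> ` Y" using bij by (simp add: bij_betw_def)
  have "bij_betw f Y Y" using f by (simp add: carrier_Iso Bij_def)
  then have "bij_betw (\<pi> \<circ> f) Y Z" using bij by (rule bij_betw_trans)
  then have "bij_betw (h \<circ> \<pi>) Y Z"
    by (rule iffD1[OF bij_betw_cong, rotated]) (simp add: h)
  \<comment> \<open>The bijection \<open>\<pi>\<close> is cancelled on the right.\<close>
  then have "bij_betw h Z Z" using bij_betw_comp_iff[OF bij] by blast
  moreover have "dZ (h u) (h v) = dZ u v" if "u \<in> Z" "v \<in> Z" for u v
    using that unfolding Z by (auto simp: h iso Iso_closed[OF f] Iso_dist[OF f])
  ultimately show ?thesis using h(1) by (simp add: carrier_Iso Bij_def)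
qed

text \<open>Transport of structure along \<open>\<pi>\<close>: each \<open>\<psi> p\<close> is the
  conjugate of \<open>\<phi> p\<close>. That domains and ranges of the members of \<open>P\<close>
  lie in \<open>X\<close> allows \<open>j\<close> to be replaced by \<open>\<pi>\<close> after
  \<open>\<iota>\<close>.\<close>

lemma S_extension_transport:
  assumes ext: "S_extension X dX P Y dY \<iota> \<phi>"
    and P: "P \<subseteq> nontrivial_partial_isometries X dX" "pinv ` P = P"
    and metZ: "Metric_space Z dZ"
    and bij: "bij_betw \<pi> Y Z"
    and iso: "\<And>x y. x \<in> Y \<Longrightarrow> y \<in> Y \<Longrightarrow> dZ (\<pi> x) (\<pi> y) = dY x y"
    and j: "\<And>x. x \<in> X \<Longrightarrow> j x = \<pi> (\<iota> x)"
    and \<psi>: "\<And>p. p \<in> P \<Longrightarrow> \<psi> p \<in> extensional Z"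
      "\<And>p y. p \<in> P \<Longrightarrow> y \<in> Y \<Longrightarrow> \<psi> p (\<pi> y) = \<pi> (\<phi> p y)"
  shows "S_extension X dX P Z dZ j \<psi>"
proof -
  interpret Y: group "Iso_group Y dY" by (rule group_Iso)
  interpret Z: group "Iso_group Z dZ" by (rule group_Iso)
  have Z: "Z = \<pi> ` Y" using bij by (simp add: bij_betw_def)
  have \<iota>: "\<And>x. x \<in> X \<Longrightarrow> \<iota> x \<in> Y"
    and \<iota>d: "\<And>x x'. x \<in> X \<Longrightarrow> x' \<in> X \<Longrightarrow> dY (\<iota> x) (\<iota> x') = dX x x'"
    and \<phi>: "\<And>p. p \<in> P \<Longrightarrow> \<phi> p \<in> carrier (Iso_group Y dY)"
    and \<phi>\<iota>: "\<And>p x. p \<in> P \<Longrightarrow> x \<in> dom p \<Longrightarrow> \<phi> p (\<iota> x) = \<iota> (the (p x))"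
    and \<phi>inv: "\<And>p. p \<in> P \<Longrightarrow> \<phi> (pinv p) = inv\<^bsub>Iso_group Y dY\<^esub> (\<phi> p)"
    using ext by (auto simp: S_extension_def Pi_iff)
  have \<psi>c: "\<psi> p \<in> carrier (Iso_group Z dZ)" if "p \<in> P" for p
    using bij iso \<phi>[OF that] \<psi>(1)[OF that] \<psi>(2)[OF that]
    by (rule Iso_transport[where \<pi> = \<pi> and f = "\<phi> p"])
  have "\<psi> p (j x) = j (the (p x))" if "p \<in> P" "x \<in> dom p" for p x
  proof -
    have "x \<in> X" "the (p x) \<in> X"
      using that P(1)
      by (force simp: nontrivial_partial_isometries_def partial_isometry_def ran_def)+
    with that show ?thesis by (simp add: j \<psi> \<iota> \<phi>\<iota>)
  qed
  moreover have "\<psi> (pinv p) = inv\<^bsub>Iso_group Z dZ\<^esub> (\<psi> p)" if p: "p \<in> P" for p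
  proof -
    have p': "pinv p \<in> P" using P(2) p by blast
    \<comment> \<open>By uniqueness of inverses a left inverse suffices. The functions are compared
      at every \<open>u\<close>; outside \<open>Z\<close> both are \<open>undefined\<close>.\<close>
    have "\<psi> (pinv p) \<otimes>\<^bsub>Iso_group Z dZ\<^esub> \<psi> p = \<one>\<^bsub>Iso_group Z dZ\<^esub>"
    proof
      fix u
      have "\<phi> (pinv p) (\<phi> p y) = y" if "y \<in> Y" for y
        using mult_Iso_apply[OF \<phi>[OF p'] \<phi>[OF p] that] Y.l_inv[OF \<phi>[OF p]] that
        by (simp add: \<phi>inv[OF p] one_Iso)
      then have "\<psi> (pinv p) (\<psi> p u) = u" if "u \<in> Z"
        using that unfolding Z
        by (auto simp: \<psi>(2)[OF p] \<psi>(2)[OF p'] Iso_closed[OF \<phi>[OF p]])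
      then show "(\<psi> (pinv p) \<otimes>\<^bsub>Iso_group Z dZ\<^esub> \<psi> p) u = \<one>\<^bsub>Iso_group Z dZ\<^esub> u"
        by (simp add: mult_Iso[OF \<psi>c[OF p'] \<psi>c[OF p]] one_Iso compose_def)
    qed
    then show ?thesis using Z.inv_equality \<psi>c p p' by metis
  qed
  ultimately show ?thesis
    unfolding S_extension_def using metZ \<psi>c
    by (auto simp: j iso \<iota> \<iota>d Z)
qed

section \<open>The orbit map on cosets\<close>

lemma word_apply_simps [simp]:
  "word_apply [] x = Some x" "word_apply (p # w) x = Option.bind (word_apply w x) p"
  by (simp_all add: word_apply_def)

locale pointed_S_extension =
  fixes X :: "'a set" and dX and P :: "('a \<rightharpoonup> 'a) set" and Y :: "'b set" and dY and \<iota> and \<phi>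
    and a :: 'a
  assumes P_isometries: "P \<subseteq> nontrivial_partial_isometries X dX"
    and P_pinv: "pinv ` P = P"
    and extension: "S_extension X dX P Y dY \<iota> \<phi>"
    and base_in: "a \<in> X"
begin

abbreviation "K \<equiv> Iso_group Y dY"
abbreviation "hat \<equiv> free_extend K \<phi>"
abbreviation "N \<equiv> kernel (free_group P) K hat"

lemma iota_in: "x \<in> X \<Longrightarrow> \<iota> x \<in> Y"
  and iota_dist: "x \<in> X \<Longrightarrow> x' \<in> X \<Longrightarrow> dY (\<iota> x) (\<iota> x') = dX x x'"
  and phi_closed: "p \<in> P \<Longrightarrow> \<phi> p \<in> carrier K"
  and phi_iota: "p \<in> P \<Longrightarrow> x \<in> dom p \<Longrightarrow> \<phi> p (\<iota> x) = \<iota> (the (p x))"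
  and metric_Y: "Metric_space Y dY"
  using extension by (auto simp: S_extension_def Pi_iff)

sublocale letter_hom K P \<phi>
  using group_Iso P_pinv extension
  by (auto simp: letter_hom_def letter_hom_axioms_def S_extension_def)

text \<open>Each \<open>\<phi> p\<close> extends \<open>p\<close>, so the isometry of a word follows
  the partial word as long as the latter is defined. Membership in \<open>X\<close> is carried along
  because \<open>\<iota>\<close> is controlled only there.\<close>

lemma word_eval_iota:
  "w \<in> lists P \<Longrightarrow> x \<in> X \<Longrightarrow> word_apply w x = Some y \<Longrightarrow>
    y \<in> X \<and> word_eval K \<phi> w (\<iota> x) = \<iota> y"
proof (induction w arbitrary: y)
  case Nil
  then show ?case by (simp add: one_Iso iota_in)
next
  case (Cons p w)
  then obtain z where z: "word_apply w x = Some z" "p z = Some y"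
    by (auto simp: bind_eq_Some_conv)
  have pw: "p \<in> P" "w \<in> lists P" using Cons.prems by auto
  have IH: "z \<in> X" "word_eval K \<phi> w (\<iota> x) = \<iota> z" using Cons.IH[OF pw(2) Cons.prems(2) z(1)] by auto
  have "y \<in> X" using pw(1) z(2) P_isometries
    by (force simp: nontrivial_partial_isometries_def partial_isometry_def ran_def)
  moreover have "\<phi> p (\<iota> z) = \<iota> y" using phi_iota[OF pw(1), of z] z(2) by auto
  ultimately show ?case
    using IH Cons.prems pw phi_closed word_eval_closed
    by (simp add: mult_Iso_apply iota_in)
qed

lemma hat_word_class_base:
  "w \<in> lists P \<Longrightarrow> word_apply w a = Some x \<Longrightarrow> x \<in> X \<and> hat (word_class P w) (\<iota> a) = \<iota> x"
  using word_eval_iota base_in by (simp add: free_extend_word_class)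

lemma hat_mult_apply:
  "g \<in> carrier (free_group P) \<Longrightarrow> h \<in> carrier (free_group P) \<Longrightarrow> y \<in> Y \<Longrightarrow>
    hat (g \<otimes>\<^bsub>free_group P\<^esub> h) y = hat g (hat h y)"
  by (simp add: free_extend_mult free_extend_closed mult_Iso_apply)

abbreviation "NH \<equiv> N <#>\<^bsub>free_group P\<^esub> point_stabilizer P a"

text \<open>\<open>N\<close> acts as the identity on \<open>Y\<close>, and a word for an element of
  \<open>H\<close> returns \<open>a\<close> to itself inside \<open>X\<close>, hence fixes
  \<open>\<iota> a\<close>.\<close>

lemma NH_fixes: "k \<in> NH \<Longrightarrow> k \<in> carrier (free_group P) \<and> hat k (\<iota> a) = \<iota> a"
proof -
  assume "k \<in> NH"
  then obtain n w where n: "n \<in> N" and w: "w \<in> lists P" "word_apply w a = Some a"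
    and k: "k = n \<otimes>\<^bsub>free_group P\<^esub> word_class P w"
    by (auto simp: set_mult_def point_stabilizer_def)
  have "n \<in> carrier (free_group P)" "hat n = \<one>\<^bsub>K\<^esub>"
    using n by (auto simp: kernel_def)
  moreover have "word_class P w \<in> carrier (free_group P)" "hat (word_class P w) (\<iota> a) = \<iota> a"
    using w hat_word_class_base[OF w] by simp_all
  ultimately show ?thesis
    unfolding k by (simp add: free_group_mult_closed hat_mult_apply one_Iso iota_in base_in)
qed

lemma one_in_NH: "\<one>\<^bsub>free_group P\<^esub> \<in> NH"
proof -
  interpret F: monoid "free_group P" by (rule monoid_free_group)
  have "\<one>\<^bsub>free_group P\<^esub> \<in> N"
    using free_extend_word_class[of "[]"] by (simp add: kernel_def one_free_group)
  moreover have "\<one>\<^bsub>free_group P\<^esub> \<in> point_stabilizer P a"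
    unfolding one_free_group point_stabilizer_def by force
  ultimately show ?thesis unfolding set_mult_def by force
qed

text \<open>Defined without choosing a representative of the coset; on cosets of \<open>NH\<close>
  the image is a singleton.\<close>

definition orbit_map :: "('a \<rightharpoonup> 'a) list set set \<Rightarrow> 'b" where
  "orbit_map C = the_elem ((\<lambda>g. hat g (\<iota> a)) ` C)"

lemma orbit_map_coset:
  assumes g: "g \<in> carrier (free_group P)"
  shows "orbit_map (NH_coset P a N g) = hat g (\<iota> a)"
proof -
  have "hat (g \<otimes>\<^bsub>free_group P\<^esub> k) (\<iota> a) = hat g (\<iota> a)" if "k \<in> NH" for k
    using NH_fixes[OF that] g by (simp add: hat_mult_apply iota_in base_in)
  moreover have "NH_coset P a N g = (\<lambda>k. g \<otimes>\<^bsub>free_group P\<^esub> k) ` NH"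
    unfolding NH_coset_def l_coset_def by (rule UNION_singleton_eq_range)
  ultimately have "(\<lambda>g. hat g (\<iota> a)) ` NH_coset P a N g = (\<lambda>k. hat g (\<iota> a)) ` NH"
    by (simp add: image_image)
  \<comment> \<open>The image of a constant map is a singleton only over a nonempty set, which
    \<open>one_in_NH\<close> provides.\<close>
  also have "\<dots> = {hat g (\<iota> a)}" using one_in_NH by blast
  finally have "(\<lambda>g. hat g (\<iota> a)) ` NH_coset P a N g = {hat g (\<iota> a)}" .
  then show ?thesis by (simp add: orbit_map_def)
qed

lemma l_coset_NH_coset:
  assumes "g \<in> carrier (free_group P)" "h \<in> carrier (free_group P)"
  shows "g <#\<^bsub>free_group P\<^esub> NH_coset P a N h = NH_coset P a N (g \<otimes>\<^bsub>free_group P\<^esub> h)"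
proof -
  have "g \<otimes>\<^bsub>free_group P\<^esub> (h \<otimes>\<^bsub>free_group P\<^esub> k) = g \<otimes>\<^bsub>free_group P\<^esub> h \<otimes>\<^bsub>free_group P\<^esub> k"
    if "k \<in> NH" for k
    using monoid.m_assoc[OF monoid_free_group assms] NH_fixes[OF that] by simp
  then show ?thesis unfolding NH_coset_def l_coset_def by simp
qed

text \<open>Equivariance of the orbit map, from multiplicativity of \<open>hat\<close>.\<close>

lemma coset_action_coset:
  assumes "g \<in> carrier (free_group P)" "C \<in> coset_space P a N"
  shows "coset_action P a N g C \<in> coset_space P a N \<and>
    orbit_map (coset_action P a N g C) = hat g (orbit_map C)"
proof -
  obtain h where h: "h \<in> carrier (free_group P)" and C: "C = NH_coset P a N h"
    using assms(2) by (auto simp: coset_space_def)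
  have gh: "g \<otimes>\<^bsub>free_group P\<^esub> h \<in> carrier (free_group P)"
    using free_group_mult_closed assms(1) h .
  have "coset_action P a N g C = NH_coset P a N (g \<otimes>\<^bsub>free_group P\<^esub> h)"
    using assms h by (simp add: coset_action_def C l_coset_NH_coset)
  then show ?thesis
    using assms(1) h gh
    by (simp add: C orbit_map_coset hat_mult_apply iota_in base_in) (simp add: coset_space_def)
qed

lemma letters1_lists: "p \<in> letters1 P \<Longrightarrow> p \<in> lists P"
  by (auto simp: letters1_def)

end

section \<open>The minimal case: the pulled back metric on the coset space\<close>

locale minimal_pointed_S_extension = pointed_S_extension +
  assumes minimal: "minimal_S_extension a P Y dY \<iota> \<phi>"
    and covers: "X - {a} \<subseteq> values_at P a"
begin

sublocale metric_pullback Y dY "coset_space P a N" orbit_map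
proof (intro metric_pullback.intro metric_pullback_axioms.intro metric_Y)
  have "orbit_map ` coset_space P a N = (\<lambda>g. hat g (\<iota> a)) ` carrier (free_group P)"
    unfolding coset_space_def image_image by (rule image_cong) (simp_all add: orbit_map_coset)
  \<comment> \<open>Minimality says that the orbit of \<open>\<iota> a\<close> fills
    \<open>Y\<close>; it stays in \<open>Y\<close> because each \<open>hat g\<close> maps
    \<open>Y\<close> to itself.\<close>
  also have "\<dots> = Y"
    using minimal free_extend_closed Iso_closed[OF _ iota_in[OF base_in]]
    by (fastforce simp: minimal_S_extension_def)
  finally show "orbit_map ` coset_space P a N = Y" .
qed

lemma pull_invariant:
  "invariant_under (coset_action P a N ` carrier (free_group P)) (coset_space P a N) pull"
  unfolding invariant_under_def pull_def
  by (auto simp: coset_action_coset F_in Iso_dist[OF free_extend_closed])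

text \<open>The ends of an edge go to the images under \<open>hat g\<close> of
  \<open>\<iota> x\<close> and \<open>\<iota> y\<close>. Both \<open>hat g\<close> and
  \<open>\<iota>\<close> preserve distances, which leaves \<open>dX x y\<close>; in particular the
  weight depends on the edge alone.\<close>

lemma pull_consistent: "consistent_with_weights dX P a N pull"
  unfolding consistent_with_weights_def
proof (intro allI impI)
  fix C D r assume "weighted_edge dX P a N C D r"
  then obtain g p q x y where g: "g \<in> carrier (free_group P)"
    and pq: "p \<in> lists P" "q \<in> lists P"
    and xy: "word_apply p a = Some x" "word_apply q a = Some y"
    and C: "C = NH_coset P a N (g \<otimes>\<^bsub>free_group P\<^esub> word_class P p)"
    and D: "D = NH_coset P a N (g \<otimes>\<^bsub>free_group P\<^esub> word_class P q)"
    and r: "r = dX x y"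
    unfolding weighted_edge_def using letters1_lists by blast
  have F: "orbit_map (NH_coset P a N (g \<otimes>\<^bsub>free_group P\<^esub> word_class P w)) = hat g (\<iota> z)"
    and z: "z \<in> X" if w: "w \<in> lists P" "word_apply w a = Some z" for w z
  proof -
    have "word_class P w \<in> carrier (free_group P)" using w by simp
    then show "orbit_map (NH_coset P a N (g \<otimes>\<^bsub>free_group P\<^esub> word_class P w)) = hat g (\<iota> z)"
      "z \<in> X"
      using g hat_word_class_base[OF w]
      by (simp_all add: free_group_mult_closed orbit_map_coset hat_mult_apply iota_in base_in)
  qed
  show "pull C D = r"
    using z[OF pq(1) xy(1)] z[OF pq(2) xy(2)] F[OF pq(1) xy(1)] F[OF pq(2) xy(2)]
    by (simp add: pull_def C D r iota_in iota_dist Iso_dist[OF free_extend_closed[OF g]])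
qed

text \<open>Every letter carrying \<open>a\<close> to \<open>x\<close> yields the same class, the
  fibre over \<open>\<iota> x\<close>, so the description in \<open>ident_embedding\<close> is
  unambiguous. A letter exists by \<open>covers\<close>, or is the empty word when
  \<open>x = a\<close>.\<close>

lemma ident_embedding_eq:
  assumes "x \<in> X"
  shows "ident_embedding P a N pull x = fibre (\<iota> x)"
  unfolding ident_embedding_def
proof (rule the_equality)
  have eq: "zero_rel (coset_space P a N) pull `` {NH_coset P a N (word_class P p)} = fibre (\<iota> x)"
    if "p \<in> letters1 P" "word_apply p a = Some x" for p
  proof -
    have p: "p \<in> lists P" using that letters1_lists by blast
    then have "NH_coset P a N (word_class P p) \<in> coset_space P a N"
      by (simp add: coset_space_def)
    then show ?thesis
      using hat_word_class_base[OF p that(2)] p by (simp add: zero_rel_pull orbit_map_coset)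
  qed
  then show "\<And>A. \<exists>p\<in>letters1 P. word_apply p a = Some x \<and>
      A = zero_rel (coset_space P a N) pull `` {NH_coset P a N (word_class P p)} \<Longrightarrow>
    A = fibre (\<iota> x)" by blast
  have "\<exists>p\<in>letters1 P. word_apply p a = Some x"
  proof (cases "x = a")
    case True
    then show ?thesis by (auto simp: letters1_def)
  next
    case False
    then obtain p where "p \<in> P" "p a = Some x"
      using covers assms by (force simp: values_at_def)
    then show ?thesis by (auto simp: letters1_def)
  qed
  with eq show "\<exists>p\<in>letters1 P. word_apply p a = Some x \<and>
      fibre (\<iota> x) = zero_rel (coset_space P a N) pull `` {NH_coset P a N (word_class P p)}"
    by blast
qed

lemma ident_action_fibre:
  assumes "p \<in> P" "y \<in> Y"
  shows "ident_action P a N pull p (fibre y) = fibre (\<phi> p y)"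
proof -
  have "hat (word_class P [p]) y = \<phi> p y"
    using assms phi_closed free_extend_word_class[of "[p]"] by simp
  moreover have "ident_action P a N pull p (fibre y) = fibre (hat (word_class P [p]) y)"
    unfolding ident_action_def
    by (rule ident_map_fibre) (use assms in \<open>simp_all add: coset_action_coset\<close>)
  ultimately show ?thesis by simp
qed

text \<open>The structure of \<open>Y\<close> is carried over along the bijection
  \<open>fibre\<close>; extensionality holds because \<open>ident_map\<close> is a restricted
  function.\<close>

lemma ident_S_extension:
  "S_extension X dX P
     (ident_space (coset_space P a N) pull) (ident_dist (coset_space P a N) pull)
     (ident_embedding P a N pull) (ident_action P a N pull)"
proof (rule S_extension_transport[OF extension P_isometries P_pinv Metric_space_ident fibre_bij])
  show "ident_action P a N pull p \<in> extensional (ident_space (coset_space P a N) pull)" for p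
    by (simp add: ident_action_def ident_map_def)
qed (fact ident_dist_fibre ident_embedding_eq ident_action_fibre)+

lemma ident_isomorphic:
  "S_extension_isomorphic P Y dY \<phi>
     (ident_space (coset_space P a N) pull) (ident_dist (coset_space P a N) pull)
     (ident_action P a N pull)"
  unfolding S_extension_isomorphic_def
  using fibre_bij ident_dist_fibre ident_action_fibre by blast

end

theorem theorem4p5:
  fixes X :: "'a set" and dX :: "'a \<Rightarrow> 'a \<Rightarrow> real" and a0 :: 'a
    and P :: "('a \<rightharpoonup> 'a) set"
    and Y :: "'b set" and dY :: "'b \<Rightarrow> 'b \<Rightarrow> real" and \<iota> :: "'a \<Rightarrow> 'b"
    and \<phi> :: "('a \<rightharpoonup> 'a) \<Rightarrow> 'b \<Rightarrow> 'b"
    and N :: "('a \<rightharpoonup> 'a) list set set"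
    and G :: "(('a \<rightharpoonup> 'a) list set set \<Rightarrow> ('a \<rightharpoonup> 'a) list set set) set"
  assumes "Metric_space X dX" and "finite X" and "a0 \<in> X"
    and "P \<subseteq> nontrivial_partial_isometries X dX"
    and "pinv ` P = P"
    and "X - {a0} \<subseteq> values_at P a0"
    and "S_extension X dX P Y dY \<iota> \<phi>" and "finite Y"
    and "minimal_S_extension a0 P Y dY \<iota> \<phi>"
    and "N = kernel (free_group P) (Iso_group Y dY) (free_extend (Iso_group Y dY) \<phi>)"
    and "G = coset_action P a0 N ` carrier (free_group P)"
  shows "\<exists>\<rho>. pseudometric_on (coset_space P a0 N) \<rho> \<and>
           invariant_under G (coset_space P a0 N) \<rho> \<and>
           consistent_with_weights dX P a0 N \<rho> \<and>
           S_extension X dX P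
             (ident_space (coset_space P a0 N) \<rho>) (ident_dist (coset_space P a0 N) \<rho>)
             (ident_embedding P a0 N \<rho>) (ident_action P a0 N \<rho>) \<and>
           S_extension_isomorphic P Y dY \<phi>
             (ident_space (coset_space P a0 N) \<rho>) (ident_dist (coset_space P a0 N) \<rho>)
             (ident_action P a0 N \<rho>)"
proof -
  interpret minimal_pointed_S_extension X dX P Y dY \<iota> \<phi> a0
    by unfold_locales (use assms in auto)
  show ?thesis
    unfolding assms(10,11)
    by (intro exI[of _ pull] conjI pseudometric_pull pull_invariant pull_consistent
        ident_S_extension ident_isomorphic)
qed

end
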